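(* For $\rho\in\widehat{G}$ and $\lambda,\mu\in\mathbb{K}$ with $\lambda\neq0$, the $H$-module $V_x(\rho,\lambda,\mu)$ is simple.
   Context: $\mathbb{K}$ is an algebraically closed field of characteristic zero, $G$ is a finitely generated abelian group, $\widehat{G}$ is the group of homomorphisms $G\to\mathbb{K}^\times$, $\chi\in\widehat{G}$ has finite order $n$, and $b,c\in G$ satisfy $\chi(b)=\chi(c)$ and $bc\neq1$. Put $e=c^{-1}-b\in\mathbb{K}[G]$. $H=H(G,\chi,\chi^{-1},b,c,1)$ is (after replacing its second Ore variable $y$ by $c^{-1}y$) the algebra generated by $G,x,y$ subject to the relations of $G$ and $xg=\chi(g)gx$, $yg=\chi(g)^{-1}gy$ $(g\in G)$, $yx=xy+e$; it has $\mathbb{K}$-basis $\{gx^iy^j\mid g\in G,\ i,j\ge 0\}$. Let $\sigma:\mathbb{K}[G]\to\mathbb{K}[G]$ be the automorphism with $\sigma(g)=\chi(g)g$, and for $u\in\mathbb{K}[G]$ let $[u]_i^\sigma=\sum_{k=0}^{i-1}\sigma^{-k}(u)$ for $i\ge1$, $[u]_0^\sigma=0$. Characters $\rho\in\widehat{G}$ are extended to algebra maps $\rho:\mathbb{K}[G]\to\mathbb{K}$. For $\rho\in\widehat{G}$ and $\lambda,\mu\in\mathbb{K}$ with $\lambda\ne0$, $V_x(\rho,\lambda,\mu)$ is the $n$-dimensional $H$-module with basis $\{v_0,\ldots,v_{n-1}\}$ and action: $x\cdot v_i=v_{i+1}$ for $0\le i\le n-2$, $x\cdot v_{n-1}=\lambda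 v_0$; $y\cdot v_0=\lambda^{-1}\mu v_{n-1}$, $y\cdot v_i=(\mu+\rho([e]_i^\sigma))v_{i-1}$ for $1\le i\le n-1$; $g\cdot v_i=\rho(\sigma^{-i}(g))v_i$ for $g\in G$ and $0\le i\le n-1$. *)

theory Defs
  imports
    "HOL-Library.Poly_Mapping"
    "HOL-Computational_Algebra.Polynomial"
    "HOL-Algebra.QuotRing"
    "HOL-Algebra.Generated_Groups"
    "HOL-Algebra.Multiplicative_Group"
begin

section \<open>The group, its characters, and its group algebra\<close>

text \<open>
  The abelian group is a type of class \<^class>\<open>ab_group_add\<close>, so it is written additively:
  the product of \<open>g\<close> and \<open>h\<close> is \<open>g + h\<close>, the inverse of \<open>c\<close> is \<open>- c\<close>, and the unit is \<open>0\<close>.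
  Its group algebra over \<open>'k\<close> is then the type of finitely supported functions from \<open>'g\<close>
  to \<open>'k\<close>, whose product in \<^theory>\<open>HOL-Library.Poly_Mapping\<close> is convolution.
\<close>

definition grp :: "'g::ab_group_add monoid" where
  "grp = \<lparr>carrier = UNIV, mult = (+), one = 0\<rparr>"

definition finitely_generated :: "'g::ab_group_add itself \<Rightarrow> bool" where
  "finitely_generated _ \<longleftrightarrow> (\<exists>S :: 'g set. finite S \<and> generate grp S = UNIV)"

definition field_units :: "'k::field monoid" where
  "field_units = \<lparr>carrier = UNIV - {0}, mult = (*), one = 1\<rparr>"

definition characters :: "('g::ab_group_add \<Rightarrow> 'k::field) monoid" where
  "characters =
     \<lparr>carrier = hom grp field_units, mult = (\<lambda>\<chi> \<psi> g. \<chi> g * \<psi> g), one = (\<lambda>_. 1)\<rparr>"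

type_synonym ('g, 'k) group_algebra = "'g \<Rightarrow>\<^sub>0 'k"

definition grp_elt :: "'g \<Rightarrow> ('g::ab_group_add, 'k::field) group_algebra" where
  "grp_elt g = Poly_Mapping.single g 1"

definition char_ext ::
  "('g::ab_group_add \<Rightarrow> 'k::field) \<Rightarrow> ('g, 'k) group_algebra \<Rightarrow> 'k" where
  "char_ext \<rho> u = (\<Sum>g\<in>Poly_Mapping.keys u. Poly_Mapping.lookup u g * \<rho> g)"

definition sigma ::
  "('g::ab_group_add \<Rightarrow> 'k::field) \<Rightarrow> ('g, 'k) group_algebra \<Rightarrow> ('g, 'k) group_algebra" where
  "sigma \<chi> u = Poly_Mapping.mapp (\<lambda>g a. \<chi> g * a) u"

definition bracket ::
  "('g::ab_group_add \<Rightarrow> 'k::field) \<Rightarrow> nat \<Rightarrow> ('g, 'k) group_algebra \<Rightarrow> ('g, 'k) group_algebra" where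
  "bracket \<chi> i u = (\<Sum>k<i. (inv_into UNIV (sigma \<chi>) ^^ k) u)"

definition e_elt :: "'g::ab_group_add \<Rightarrow> 'g \<Rightarrow> ('g, 'k::field) group_algebra" where
  "e_elt b c = grp_elt (- c) - grp_elt b"


section \<open>The algebra \<open>H\<close>\<close>

text \<open>
  Words form a monoid under concatenation, so the free algebra on a set of letters is the
  monoid algebra of finitely supported functions on words.
\<close>

instantiation list :: (type) monoid_add
begin
definition zero_list :: "'a list" where "zero_list = []"
definition plus_list :: "'a list \<Rightarrow> 'a list \<Rightarrow> 'a list" where "plus_list = (@)"
instance by standard (simp_all add: zero_list_def plus_list_def)
end

datatype 'g letter = Letter_G 'g | Letter_x | Letter_y

type_synonym ('g, 'k) free_algebra = "'g letter list \<Rightarrow>\<^sub>0 'k"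

definition scalar :: "'k \<Rightarrow> ('g, 'k::field) free_algebra" where
  "scalar a = Poly_Mapping.single [] a"

definition gen :: "'g letter \<Rightarrow> ('g, 'k::field) free_algebra" where
  "gen s = Poly_Mapping.single [s] 1"

definition in_free :: "('g::ab_group_add, 'k::field) group_algebra \<Rightarrow> ('g, 'k) free_algebra" where
  "in_free u =
     (\<Sum>g\<in>Poly_Mapping.keys u. scalar (Poly_Mapping.lookup u g) * gen (Letter_G g))"

definition free_ring :: "('g, 'k::field) free_algebra ring" where
  "free_ring = \<lparr>carrier = UNIV, mult = (*), one = 1, zero = 0, add = (+)\<rparr>"

definition H_relators ::
  "('g::ab_group_add \<Rightarrow> 'k::field) \<Rightarrow> 'g \<Rightarrow> 'g \<Rightarrow> ('g, 'k) free_algebra set" where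
  "H_relators \<chi> b c =
     {gen (Letter_G g) * gen (Letter_G h) - gen (Letter_G (g + h)) | g h. True} \<union>
     {gen (Letter_G 0) - 1} \<union>
     {gen Letter_x * gen (Letter_G g)
        - scalar (\<chi> g) * gen (Letter_G g) * gen Letter_x | g. True} \<union>
     {gen Letter_y * gen (Letter_G g)
        - scalar (inverse (\<chi> g)) * gen (Letter_G g) * gen Letter_y | g. True} \<union>
     {gen Letter_y * gen Letter_x - gen Letter_x * gen Letter_y - in_free (e_elt b c)}"

text \<open>
  A two-sided ring ideal of a unital algebra is closed under scalars, so the ring ideal
  generated by the relators is also the algebra ideal they generate.
\<close>

definition H_ideal ::
  "('g::ab_group_add \<Rightarrow> 'k::field) \<Rightarrow> 'g \<Rightarrow> 'g \<Rightarrow> ('g, 'k) free_algebra set" where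
  "H_ideal \<chi> b c = Idl\<^bsub>free_ring\<^esub> (H_relators \<chi> b c)"

definition H_ring ::
  "('g::ab_group_add \<Rightarrow> 'k::field) \<Rightarrow> 'g \<Rightarrow> 'g \<Rightarrow> ('g, 'k) free_algebra set ring" where
  "H_ring \<chi> b c = free_ring Quot (H_ideal \<chi> b c)"

definition H_class ::
  "('g::ab_group_add \<Rightarrow> 'k::field) \<Rightarrow> 'g \<Rightarrow> 'g \<Rightarrow> ('g, 'k) free_algebra \<Rightarrow> ('g, 'k) free_algebra set"
  where "H_class \<chi> b c a = H_ideal \<chi> b c +>\<^bsub>free_ring\<^esub> a"


section \<open>Modules\<close>

text \<open>
  Left modules over a possibly noncommutative ring \<open>R\<close>; the underlying abelian group is the
  whole type \<open>'v\<close>.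
\<close>

locale left_module = ring R for R (structure) +
  fixes act :: "'a \<Rightarrow> 'v::ab_group_add \<Rightarrow> 'v"
  assumes act_add_right: "r \<in> carrier R \<Longrightarrow> act r (v + w) = act r v + act r w"
    and act_add_left:
      "r \<in> carrier R \<Longrightarrow> s \<in> carrier R \<Longrightarrow> act (r \<oplus> s) v = act r v + act s v"
    and act_mult:
      "r \<in> carrier R \<Longrightarrow> s \<in> carrier R \<Longrightarrow> act (r \<otimes> s) v = act r (act s v)"
    and act_one: "act \<one> v = v"

definition left_submodule ::
  "('a, 'b) ring_scheme \<Rightarrow> ('a \<Rightarrow> 'v::ab_group_add \<Rightarrow> 'v) \<Rightarrow> 'v set \<Rightarrow> bool" where
  "left_submodule R act W \<longleftrightarrow>
     0 \<in> W \<and> (\<forall>v\<in>W. \<forall>w\<in>W. v + w \<in> W) \<and> (\<forall>r\<in>carrier R. \<forall>w\<in>W. act r w \<in> W)"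

definition simple_left_module ::
  "('a, 'b) ring_scheme \<Rightarrow> ('a \<Rightarrow> 'v::ab_group_add \<Rightarrow> 'v) \<Rightarrow> bool" where
  "simple_left_module R act \<longleftrightarrow>
     left_module R act \<and> (UNIV :: 'v set) \<noteq> {0} \<and>
     (\<forall>W. left_submodule R act W \<longrightarrow> W = {0} \<or> W = UNIV)"

text \<open>The vector space structure that a module over \<open>H\<close> carries through the scalars of \<open>H\<close>.\<close>

definition H_scale ::
  "('g::ab_group_add \<Rightarrow> 'k::field) \<Rightarrow> 'g \<Rightarrow> 'g \<Rightarrow>
   (('g, 'k) free_algebra set \<Rightarrow> 'v::ab_group_add \<Rightarrow> 'v) \<Rightarrow> 'k \<Rightarrow> 'v \<Rightarrow> 'v" where
  "H_scale \<chi> b c act a w = act (H_class \<chi> b c (scalar a)) w"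

text \<open>
  \<open>is_V_x n \<chi> b c \<rho> \<lambda> \<mu> act v\<close>: the action \<open>act\<close> makes \<open>'v\<close> an \<open>H\<close>-module with basis
  \<open>v 0, \<dots>, v (n - 1)\<close> on which the generators act by the formulas defining
  \<open>V\<^sub>x(\<rho>, \<lambda>, \<mu>)\<close>. Since the generators generate \<open>H\<close>, this determines \<open>act\<close> on \<open>H\<close>; values
  of \<open>v\<close> from \<open>n\<close> on, and of \<open>act\<close> outside the carrier, are irrelevant. The formulas respect
  \<open>yx = xy + e\<close> on \<open>v (n - 1)\<close> exactly when \<open>\<rho>([e]\<^sub>n) = 0\<close>; this is automatic for \<open>\<chi>(b) \<noteq> 1\<close>,
  and for \<open>\<chi>(b) = 1\<close> it says \<open>\<rho>(bc) = 1\<close>.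
\<close>

definition is_V_x ::
  "nat \<Rightarrow> ('g::ab_group_add \<Rightarrow> 'k::field) \<Rightarrow> 'g \<Rightarrow> 'g \<Rightarrow> ('g \<Rightarrow> 'k) \<Rightarrow> 'k \<Rightarrow> 'k \<Rightarrow>
   (('g, 'k) free_algebra set \<Rightarrow> 'v::ab_group_add \<Rightarrow> 'v) \<Rightarrow> (nat \<Rightarrow> 'v) \<Rightarrow> bool" where
  "is_V_x n \<chi> b c \<rho> l \<mu> act v \<longleftrightarrow>
     (let cl = H_class \<chi> b c; sc = H_scale \<chi> b c act;
          x = cl (gen Letter_x); y = cl (gen Letter_y) in
     left_module (H_ring \<chi> b c) act \<and>
     inj_on v {..<n} \<and> \<not> Modules.module.dependent sc (v ` {..<n}) \<and>
     Modules.module.span sc (v ` {..<n}) = UNIV \<and>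
     (\<forall>i. i + 1 < n \<longrightarrow> act x (v i) = v (i + 1)) \<and>
     act x (v (n - 1)) = sc l (v 0) \<and>
     act y (v 0) = sc (inverse l * \<mu>) (v (n - 1)) \<and>
     (\<forall>i. 1 \<le> i \<and> i < n \<longrightarrow>
        act y (v i) = sc (\<mu> + char_ext \<rho> (bracket \<chi> i (e_elt b c))) (v (i - 1))) \<and>
     (\<forall>g i. i < n \<longrightarrow>
        act (cl (gen (Letter_G g))) (v i)
          = sc (char_ext \<rho> ((inv_into UNIV (sigma \<chi>) ^^ i) (grp_elt g))) (v i)))"

end

theory Submission
  imports Defs
begin

text \<open>
  Each \<open>v i\<close> is a common eigenvector of \<open>G\<close>, with weight \<open>g \<mapsto> \<rho>(g) \<chi>(g)\<^sup>-\<^sup>i\<close>. Because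
  \<open>\<chi>\<close> has order exactly \<open>n\<close>, the weights of \<open>v 0, \<dots>, v (n - 1)\<close> are pairwise distinct
  (\<open>weights_distinct\<close>), so a submodule contains, together with a vector, all the components of
  this vector along the \<open>v i\<close> (\<open>eigencomponents_mem\<close>). A nonzero submodule therefore contains
  some \<open>v i\<close>. Since \<open>l \<noteq> 0\<close>, the generator \<open>x\<close> permutes the lines spanned by the \<open>v i\<close>
  cyclically, so the submodule contains the whole basis.

  The rest connects this argument with the presentation of \<open>H\<close>: scalars make a left
  \<open>H\<close>-module a vector space, on which every element of \<open>H\<close> acts linearly because scalars are
  central in the free algebra.
\<close>

section \<open>Modules over \<open>H\<close> as vector spaces\<close>

lemma ring_free_ring: "ring (free_ring :: ('g::ab_group_add, 'k::field) free_algebra ring)"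
proof (rule ringI)
  show "abelian_group (free_ring :: ('g, 'k) free_algebra ring)"
  proof (rule abelian_groupI)
    fix p :: "('g, 'k) free_algebra"
    have "- p + p = 0" by simp
    then show "\<exists>q\<in>carrier free_ring. q \<oplus>\<^bsub>free_ring\<^esub> p = \<zero>\<^bsub>free_ring\<^esub>"
      by (auto simp: free_ring_def intro: exI[of _ "- p"])
  qed (auto simp: free_ring_def algebra_simps)
  show "Group.monoid (free_ring :: ('g, 'k) free_algebra ring)"
    by (rule Group.monoidI) (auto simp: free_ring_def algebra_simps)
qed (auto simp: free_ring_def algebra_simps)

lemma H_class_ring_hom: "H_class \<chi> b c \<in> ring_hom free_ring (H_ring \<chi> b c)"
proof -
  interpret F: ring "free_ring :: ('a, 'b) free_algebra ring" by (rule ring_free_ring)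
  have "ideal (H_ideal \<chi> b c) free_ring"
    unfolding H_ideal_def by (rule F.genideal_ideal) (simp add: free_ring_def)
  from ideal.rcos_ring_hom[OF this] show ?thesis
    unfolding H_ring_def H_class_def by simp
qed

lemma scalar_central: "p * scalar a = scalar a * p"
proof (induction p rule: Poly_Mapping.update_induct)
  case (update p w k)
  have "Poly_Mapping.update w k p = Poly_Mapping.single w k + p"
    using update.hyps(1)
    by (intro poly_mapping_eqI)
      (auto simp: lookup_update lookup_add lookup_single when_def in_keys_iff)
  moreover have "Poly_Mapping.single w k * scalar a = scalar a * Poly_Mapping.single w k"
    by (simp add: scalar_def Poly_Mapping.mult_single mult.commute zero_list_def[symmetric])
  ultimately show ?case
    by (simp add: distrib_left distrib_right update.IH)
qed simp

context
  fixes \<chi> :: "'g::ab_group_add \<Rightarrow> 'k::field" and b c :: 'g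
    and act :: "('g, 'k) free_algebra set \<Rightarrow> 'v::ab_group_add \<Rightarrow> 'v"
  assumes module: "left_module (H_ring \<chi> b c) act"
begin

interpretation M: left_module "H_ring \<chi> b c" act by (rule module)

lemma H_class_closed: "H_class \<chi> b c p \<in> carrier (H_ring \<chi> b c)"
  using ring_hom_closed[OF H_class_ring_hom] by (simp add: free_ring_def)

lemma act_class_add:
  "act (H_class \<chi> b c (p + q)) w = act (H_class \<chi> b c p) w + act (H_class \<chi> b c q) w"
proof -
  have "H_class \<chi> b c (p + q) = H_class \<chi> b c p \<oplus>\<^bsub>H_ring \<chi> b c\<^esub> H_class \<chi> b c q"
    using ring_hom_add[OF H_class_ring_hom, of p q \<chi> b c] by (simp add: free_ring_def)
  then show ?thesis by (simp add: M.act_add_left H_class_closed)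
qed

lemma act_class_mult:
  "act (H_class \<chi> b c (p * q)) w = act (H_class \<chi> b c p) (act (H_class \<chi> b c q) w)"
proof -
  have "H_class \<chi> b c (p * q) = H_class \<chi> b c p \<otimes>\<^bsub>H_ring \<chi> b c\<^esub> H_class \<chi> b c q"
    using ring_hom_mult[OF H_class_ring_hom, of p q \<chi> b c] by (simp add: free_ring_def)
  then show ?thesis by (simp add: M.act_mult H_class_closed)
qed

lemma act_class_one: "act (H_class \<chi> b c 1) w = w"
  using ring_hom_one[OF H_class_ring_hom, of \<chi> b c] by (simp add: free_ring_def M.act_one)

lemma vector_space_H_scale: "vector_space (H_scale \<chi> b c act)"
proof
  fix a a' :: 'k and w w' :: 'v
  show "H_scale \<chi> b c act a (w + w') = H_scale \<chi> b c act a w + H_scale \<chi> b c act a w'"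
    by (simp add: H_scale_def M.act_add_right H_class_closed)
  have "scalar (a + a') = (scalar a + scalar a' :: ('g, 'k) free_algebra)"
    by (simp add: scalar_def single_add)
  then show "H_scale \<chi> b c act (a + a') w = H_scale \<chi> b c act a w + H_scale \<chi> b c act a' w"
    by (simp add: H_scale_def act_class_add)
  have "scalar (a * a') = (scalar a * scalar a' :: ('g, 'k) free_algebra)"
    by (simp add: scalar_def Poly_Mapping.mult_single zero_list_def[symmetric])
  then show "H_scale \<chi> b c act a (H_scale \<chi> b c act a' w) = H_scale \<chi> b c act (a * a') w"
    by (simp add: H_scale_def act_class_mult)
  have "scalar 1 = (1 :: ('g, 'k) free_algebra)"
    by (simp add: scalar_def zero_list_def[symmetric])
  then show "H_scale \<chi> b c act 1 w = w"
    by (simp add: H_scale_def act_class_one)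
qed

lemma act_class_scale:
  "act (H_class \<chi> b c p) (H_scale \<chi> b c act a w) = H_scale \<chi> b c act a (act (H_class \<chi> b c p) w)"
  unfolding H_scale_def act_class_mult[symmetric] scalar_central ..

lemma act_class_linear:
  "Vector_Spaces.linear (H_scale \<chi> b c act) (H_scale \<chi> b c act) (act (H_class \<chi> b c p))"
  by (simp add: Vector_Spaces.linear_iff act_class_scale M.act_add_right H_class_closed
      vector_space_H_scale)

lemma submodule_subspace:
  assumes "left_submodule (H_ring \<chi> b c) act W"
  shows "Modules.module.subspace (H_scale \<chi> b c act) W"
proof -
  interpret vector_space "H_scale \<chi> b c act" by (rule vector_space_H_scale)
  from assms show ?thesis
    by (auto simp: subspace_def left_submodule_def H_scale_def H_class_closed)
qed

lemma submodule_act_class: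
  assumes "left_submodule (H_ring \<chi> b c) act W" and "w \<in> W"
  shows "act (H_class \<chi> b c p) w \<in> W"
  using assms by (auto simp: left_submodule_def H_class_closed)

end


section \<open>Weights\<close>

lemma group_field_units: "group field_units"
proof (rule groupI)
  fix x :: 'a assume "x \<in> carrier field_units"
  then show "\<exists>y\<in>carrier field_units. y \<otimes>\<^bsub>field_units\<^esub> x = \<one>\<^bsub>field_units\<^esub>"
    by (auto simp: field_units_def intro: bexI[of _ "inverse x"])
qed (auto simp: field_units_def)

lemma carrier_characters_iff:
  "\<psi> \<in> carrier characters \<longleftrightarrow> (\<forall>g. \<psi> g \<noteq> 0) \<and> (\<forall>g h. \<psi> (g + h) = \<psi> g * \<psi> h)"
  by (auto simp: characters_def hom_def grp_def field_units_def Pi_def)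

lemma character_zero:
  assumes "\<psi> \<in> carrier characters"
  shows "\<psi> 0 = 1"
proof -
  have "\<psi> 0 * \<psi> 0 = \<psi> 0 * 1" and "\<psi> 0 \<noteq> 0"
    using assms unfolding carrier_characters_iff by (metis add_0 mult.right_neutral)+
  then show ?thesis by simp
qed

lemma group_characters: "group (characters :: ('g::ab_group_add \<Rightarrow> 'k::field) monoid)"
proof (rule groupI)
  fix \<psi> :: "'g \<Rightarrow> 'k" assume \<psi>: "\<psi> \<in> carrier characters"
  have "(\<lambda>g. inverse (\<psi> g)) \<in> carrier characters"
    using \<psi> by (auto simp: carrier_characters_iff)
  moreover have "(\<lambda>g. inverse (\<psi> g)) \<otimes>\<^bsub>characters\<^esub> \<psi> = \<one>\<^bsub>characters\<^esub>"
    using \<psi> unfolding carrier_characters_iff by (simp add: characters_def)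
  ultimately show "\<exists>\<phi>\<in>carrier characters. \<phi> \<otimes>\<^bsub>characters\<^esub> \<psi> = \<one>\<^bsub>characters\<^esub>" 
    by (intro bexI[of _ "\<lambda>g. inverse (\<psi> g)"])
next
  fix \<phi> \<psi> :: "'g \<Rightarrow> 'k" assume "\<phi> \<in> carrier characters" "\<psi> \<in> carrier characters"
  then have "(\<lambda>g. \<phi> g * \<psi> g) \<in> carrier characters"
    by (auto simp: carrier_characters_iff)
  then show "\<phi> \<otimes>\<^bsub>characters\<^esub> \<psi> \<in> carrier characters"
    by (simp add: characters_def)
next
  have "(\<lambda>_. 1) \<in> carrier (characters :: ('g \<Rightarrow> 'k) monoid)"
    by (auto simp: carrier_characters_iff)
  then show "\<one>\<^bsub>characters\<^esub> \<in> carrier (characters :: ('g \<Rightarrow> 'k) monoid)"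
    by (simp add: characters_def)
qed (auto simp: characters_def mult.assoc)

lemma characters_pow: "\<psi> [^]\<^bsub>characters\<^esub> (m::nat) = (\<lambda>g. \<psi> g ^ m)"
  by (induction m) (auto simp: characters_def nat_pow_def mult.commute)

lemma powers_of_character_distinct:
  assumes \<chi>: "\<chi> \<in> carrier characters" and "i < j" and "j < group.ord characters \<chi>"
  shows "\<exists>g. \<chi> g ^ i \<noteq> \<chi> g ^ j"
proof (rule ccontr)
  assume "\<nexists>g. \<chi> g ^ i \<noteq> \<chi> g ^ j"
  then have eq: "\<chi> g ^ i * \<chi> g ^ (j - i) = \<chi> g ^ i * 1" for g
    using \<open>i < j\<close> by (metis le_add_diff_inverse less_imp_le mult.right_neutral power_add)
  have "\<chi> g ^ (j - i) = 1" for g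
    using eq[of g] \<chi> by (simp add: carrier_characters_iff)
  then have "\<chi> [^]\<^bsub>characters\<^esub> (j - i) = \<one>\<^bsub>characters\<^esub>"
    unfolding characters_pow by (simp add: characters_def)
  then have "group.ord characters \<chi> dvd j - i"
    using group.pow_eq_id[OF group_characters \<chi>] by blast
  then show False
    using assms(2,3) by (auto dest: dvd_imp_le)
qed

lemma sigma_single: "sigma \<chi> (Poly_Mapping.single g a) = Poly_Mapping.single g (\<chi> g * a)"
  by (rule poly_mapping_eqI)
    (auto simp: sigma_def mapp.rep_eq lookup_single when_def in_keys_iff)

lemma inj_sigma:
  assumes "\<chi> \<in> carrier characters"
  shows "inj (sigma \<chi>)"
proof (rule injI, rule poly_mapping_eqI)
  fix u u' g assume "sigma \<chi> u = sigma \<chi> u'"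
  then have "Poly_Mapping.lookup (sigma \<chi> u) g = Poly_Mapping.lookup (sigma \<chi> u') g" by simp
  then have "\<chi> g * Poly_Mapping.lookup u g = \<chi> g * Poly_Mapping.lookup u' g"
    by (auto simp: sigma_def mapp.rep_eq when_def in_keys_iff split: if_splits)
  then show "Poly_Mapping.lookup u g = Poly_Mapping.lookup u' g"
    using assms by (simp add: carrier_characters_iff)
qed

lemma inv_sigma_funpow_single:
  assumes "\<chi> \<in> carrier characters"
  shows "(inv_into UNIV (sigma \<chi>) ^^ i) (Poly_Mapping.single g a)
    = Poly_Mapping.single g (inverse (\<chi> g) ^ i * a)"
proof (induction i)
  case (Suc i)
  have "\<chi> g \<noteq> 0" using assms by (simp add: carrier_characters_iff)
  then have "Poly_Mapping.single g (inverse (\<chi> g) ^ i * a)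
      = sigma \<chi> (Poly_Mapping.single g (inverse (\<chi> g) ^ Suc i * a))"
    by (simp add: sigma_single mult.assoc[symmetric])
  then show ?case
    using Suc inj_sigma[OF assms] by (simp add: inv_f_f)
qed simp

lemma weight_eq:
  assumes "\<chi> \<in> carrier characters"
  shows "char_ext \<rho> ((inv_into UNIV (sigma \<chi>) ^^ i) (grp_elt g)) = inverse (\<chi> g) ^ i * \<rho> g"
  by (simp add: grp_elt_def inv_sigma_funpow_single[OF assms] char_ext_def)

lemma weights_distinct:
  assumes \<chi>: "\<chi> \<in> carrier characters" and \<rho>: "\<rho> \<in> carrier characters"
    and "i < group.ord characters \<chi>" and "j < group.ord characters \<chi>" and "i \<noteq> j"
  shows "\<exists>g. inverse (\<chi> g) ^ i * \<rho> g \<noteq> inverse (\<chi> g) ^ j * \<rho> g"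
proof -
  obtain g where "\<chi> g ^ i \<noteq> \<chi> g ^ j"
    using powers_of_character_distinct[OF \<chi>] assms(3-5) by (metis linorder_neqE_nat)
  then show ?thesis
    using \<rho> by (auto simp: carrier_characters_iff power_inverse intro!: exI[of _ g])
qed

text \<open>
  Applying \<open>T g\<close> minus its eigenvalue on \<open>u j\<close> removes the component \<open>u j\<close> and rescales the
  others; by induction the rescaled components lie in \<open>W\<close>, and for each \<open>i \<noteq> j\<close> some \<open>g\<close>
  makes the factor of \<open>u i\<close> invertible.
\<close>

lemma (in vector_space) eigencomponents_mem:
  assumes "finite I"
    and W: "subspace W" "\<And>g w. w \<in> W \<Longrightarrow> T g w \<in> W"
    and T: "\<And>g. Vector_Spaces.linear scale scale (T g)"
    and distinct: "\<And>i j. i \<in> I \<Longrightarrow> j \<in> I \<Longrightarrow> i \<noteq> j \<Longrightarrow> \<exists>g. q g i \<noteq> q g j"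
    and eigen: "\<And>g i. i \<in> I \<Longrightarrow> T g (u i) = scale (q g i) (u i)"
    and "(\<Sum>i\<in>I. u i) \<in> W" and "i \<in> I"
  shows "u i \<in> W"
  using assms(1,5-)
proof (induction I arbitrary: u i rule: finite_induct)
  case (insert j I)
  interpret T: Vector_Spaces.linear scale scale "T g" for g by (rule T)
  have eigen: "T g (u i) = scale (q g i) (u i)" if "i \<in> insert j I" for g i
    using insert.prems(2) that .
  have others: "u i \<in> W" if i: "i \<in> I" for i
  proof -
    have "i \<noteq> j" using i insert.hyps by auto
    obtain g where g: "q g i \<noteq> q g j"
      using insert.prems(1)[of i j] i \<open>i \<noteq> j\<close> by blast
    have "T g (\<Sum>i\<in>insert j I. u i) - scale (q g j) (\<Sum>i\<in>insert j I. u i) \<in> W"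
      using W insert.prems(3) by (intro subspace_diff subspace_scale) auto
    also have "T g (\<Sum>i\<in>insert j I. u i) - scale (q g j) (\<Sum>i\<in>insert j I. u i)
        = (\<Sum>i\<in>insert j I. scale (q g i - q g j) (u i))"
      by (simp only: T.sum scale_sum_right sum_subtractf[symmetric] scale_left_diff_distrib eigen
          cong: sum.cong)
    also have "\<dots> = (\<Sum>i\<in>I. scale (q g i - q g j) (u i))"
      using insert.hyps by simp
    finally have sum_mem: "(\<Sum>i\<in>I. scale (q g i - q g j) (u i)) \<in> W" .
    have "scale (q g i - q g j) (u i) \<in> W"
    proof (rule insert.IH[OF _ _ sum_mem i])
      show "T h (scale (q g k - q g j) (u k)) = scale (q h k) (scale (q g k - q g j) (u k))"
        if "k \<in> I" for h k
        using that by (simp add: T.scale eigen mult.commute)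
    qed (use insert.prems(1) in auto)
    then have "scale (inverse (q g i - q g j)) (scale (q g i - q g j) (u i)) \<in> W"
      by (rule subspace_scale[OF W(1)])
    then show "u i \<in> W" using g by simp
  qed
  have "(\<Sum>i\<in>insert j I. u i) - (\<Sum>i\<in>I. u i) \<in> W"
    by (rule subspace_diff[OF W(1) insert.prems(3) subspace_sum[OF W(1) others]])
  then have "u j \<in> W" using insert.hyps by simp
  then show ?case using others insert.prems(4) by auto
qed simp


section \<open>Simplicity\<close>

theorem proposition5p12:
  fixes \<chi> \<rho> :: "'g::ab_group_add \<Rightarrow> 'k::{alg_closed_field, field_char_0}"
    and b c :: 'g and l \<mu> :: 'k and n :: nat
    and act :: "('g, 'k) free_algebra set \<Rightarrow> 'v::ab_group_add \<Rightarrow> 'v" and v :: "nat \<Rightarrow> 'v"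
  assumes "finitely_generated TYPE('g)"
    and "\<chi> \<in> carrier characters" and "group.ord characters \<chi> = n" and "n > 0"
    and "\<chi> b = \<chi> c" and "b + c \<noteq> 0"
    and "\<rho> \<in> carrier characters" and "l \<noteq> 0"
    and "is_V_x n \<chi> b c \<rho> l \<mu> act v"
  shows "simple_left_module (H_ring \<chi> b c) act"
proof -
  define X where "X = act (H_class \<chi> b c (gen Letter_x))"
  define T where "T g = act (H_class \<chi> b c (gen (Letter_G g)))" for g
  define q where "q g i = inverse (\<chi> g) ^ i * \<rho> g" for g i
  have module: "left_module (H_ring \<chi> b c) act"
    using assms(9) by (simp add: is_V_x_def Let_def)
  interpret vector_space "H_scale \<chi> b c act" by (rule vector_space_H_scale[OF module])
  let ?sc = "H_scale \<chi> b c act"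
  have inj: "inj_on v {..<n}" and indep: "independent (v ` {..<n})"
    and span: "span (v ` {..<n}) = UNIV"
    and X_step: "\<And>i. i + 1 < n \<Longrightarrow> X (v i) = v (i + 1)"
    and X_last: "X (v (n - 1)) = ?sc l (v 0)"
    using assms(9) by (auto simp: is_V_x_def Let_def X_def)
  have eigen: "T g (v i) = ?sc (q g i) (v i)" if "i < n" for g i
    using assms(9) that by (simp add: is_V_x_def Let_def T_def q_def weight_eq[OF assms(2)])
  have "v 0 \<noteq> 0"
    using indep dependent_zero[of "v ` {..<n}"] \<open>n > 0\<close> by (metis imageI lessThan_iff)
  then have nontrivial: "(UNIV :: 'v set) \<noteq> {0}" by blast
  have "W = UNIV" if W: "left_submodule (H_ring \<chi> b c) act W" and "W \<noteq> {0}" for W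
  proof -
    have sub: "subspace W" by (rule submodule_subspace[OF module W])
    have X_mem: "X w \<in> W" if "w \<in> W" for w
      unfolding X_def by (rule submodule_act_class[OF module W that])
    obtain w where w: "w \<in> W" "w \<noteq> 0"
      using \<open>W \<noteq> {0}\<close> subspace_0[OF sub] by blast
    have "w \<in> span (v ` {..<n})" using span by simp
    then obtain a where "w = (\<Sum>z\<in>v ` {..<n}. ?sc (a z) z)"
      by (auto simp: span_finite)
    then have w_eq: "w = (\<Sum>i<n. ?sc (a (v i)) (v i))"
      by (simp add: sum.reindex[OF inj])
    obtain i where i: "i < n" "a (v i) \<noteq> 0"
      using w(2) unfolding w_eq by (metis (no_types, lifting) lessThan_iff scale_zero_left sum.neutral)
    have "?sc (a (v i)) (v i) \<in> W"
    proof (rule eigencomponents_mem[where I = "{..<n}" and T = T and q = q])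
      show "T g w \<in> W" if "w \<in> W" for g w
        unfolding T_def by (rule submodule_act_class[OF module W that])
      show "Vector_Spaces.linear ?sc ?sc (T g)" for g
        unfolding T_def by (rule act_class_linear[OF module])
      show "\<exists>g. q g j \<noteq> q g k" if "j \<in> {..<n}" "k \<in> {..<n}" "j \<noteq> k" for j k
        using weights_distinct[OF assms(2,7)] that assms(3) by (auto simp: q_def)
      show "T g (?sc (a (v j)) (v j)) = ?sc (q g j) (?sc (a (v j)) (v j))" if "j \<in> {..<n}" for g j
        using that eigen[of j g] act_class_scale[OF module]
        by (simp add: T_def mult.commute)
    qed (use sub w(1) w_eq i(1) in auto)
    then have "?sc (inverse (a (v i))) (?sc (a (v i)) (v i)) \<in> W"
      by (rule subspace_scale[OF sub])
    then have v_i: "v i \<in> W" using i(2) by simp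
    \<comment> \<open>\<open>x\<close> only raises indices, so \<open>v 0, \<dots>, v (i - 1)\<close> are reached by climbing to
      \<open>v (n - 1)\<close> and wrapping around through \<open>l \<cdot> v 0\<close>.\<close>
    have up: "v (j + k) \<in> W" if "v j \<in> W" "j + k < n" for j k
      using that(2)
    proof (induction k)
      case (Suc k)
      then have "X (v (j + k)) \<in> W" by (intro X_mem) auto
      then show ?case using X_step[of "j + k"] Suc.prems by simp
    qed (use that(1) in simp)
    have "v (n - 1) \<in> W"
      using up[OF v_i, of "n - 1 - i"] i(1) by simp
    then have "?sc (inverse l) (?sc l (v 0)) \<in> W"
      using X_mem X_last by (metis subspace_scale[OF sub])
    then have "v 0 \<in> W" using \<open>l \<noteq> 0\<close> by simp
    then have "v ` {..<n} \<subseteq> W" using up[of 0] by auto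
    then have "span (v ` {..<n}) \<subseteq> W" by (rule span_minimal[OF _ sub])
    then show "W = UNIV" using span by auto
  qed
  then show ?thesis
    using module nontrivial unfolding simple_left_module_def by blast
qed

end
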